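(* Let $P$ be a simple $2\times k$ zero-one matrix. Then there exist a constant $c>0$ and a function $f(n)=n^{1-o(1)}$ (as $n\to\infty$) such that every $P$-free $n\times n$ zero-one matrix contains a homogeneous $f(n)\times cn$ submatrix (with $f(n)$ rows and $cn$ columns).
   Context: A zero-one matrix $P$ is acyclic if every submatrix of $P$ has a row or a column containing at most one 1-entry. The complement $P^c$ of $P$ is obtained by swapping 0s and 1s. $P$ is simple if both $P$ and $P^c$ are acyclic. A matrix is homogeneous if all its entries are equal. A $k\times \ell$ matrix $P$ is contained in $A$ if there are rows $i_1<\dots<i_k$ and columns $j_1<\dots<j_\ell$ of $A$ with $A(i_a,j_b)=P(a,b)$ for all $a,b$; $A$ is $P$-free if it does not contain $P$. Floors and ceilings are omitted. *)

theory Defs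
  imports Jordan_Normal_Form.Matrix "HOL-Library.Landau_Symbols"
begin

text \<open>
  A zero-one matrix is a \<open>bool mat\<close>, where \<open>True\<close> stands for the entry 1 and \<open>False\<close> for
  the entry 0. Row and column indices start at 0.
\<close>

definition mat_contains :: "'a mat \<Rightarrow> 'a mat \<Rightarrow> bool" where
  "mat_contains A P \<longleftrightarrow>
     (\<exists>r s :: nat \<Rightarrow> nat.
        strict_mono_on {..<dim_row P} r \<and> r ` {..<dim_row P} \<subseteq> {..<dim_row A} \<and>
        strict_mono_on {..<dim_col P} s \<and> s ` {..<dim_col P} \<subseteq> {..<dim_col A} \<and>
        (\<forall>a < dim_row P. \<forall>b < dim_col P. A $$ (r a, s b) = P $$ (a, b)))"

definition mat_free :: "'a mat \<Rightarrow> 'a mat \<Rightarrow> bool" where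
  "mat_free P A \<longleftrightarrow> \<not> mat_contains A P"

text \<open>
  The submatrices of \<open>P\<close> are exactly the matrices contained in \<open>P\<close>. Those without rows or
  without columns are left out here: the \<open>0 \<times> 0\<close> matrix has no row and no column at all, so
  with it no matrix would be acyclic.
\<close>

definition acyclic_mat :: "bool mat \<Rightarrow> bool" where
  "acyclic_mat P \<longleftrightarrow>
     (\<forall>B. mat_contains P B \<and> 0 < dim_row B \<and> 0 < dim_col B \<longrightarrow>
        (\<exists>i < dim_row B. card {j. j < dim_col B \<and> B $$ (i, j)} \<le> 1) \<or>
        (\<exists>j < dim_col B. card {i. i < dim_row B \<and> B $$ (i, j)} \<le> 1))"

definition complement_mat :: "bool mat \<Rightarrow> bool mat" where
  "complement_mat P = map_mat Not P"

definition simple_mat :: "bool mat \<Rightarrow> bool" where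
  "simple_mat P \<longleftrightarrow> acyclic_mat P \<and> acyclic_mat (complement_mat P)"

definition homogeneous_mat :: "'a mat \<Rightarrow> bool" where
  "homogeneous_mat A \<longleftrightarrow>
     (\<exists>x. \<forall>i < dim_row A. \<forall>j < dim_col A. A $$ (i, j) = x)"

text \<open>\<open>f(n) = n\<^sup>1\<^sup>-\<^sup>o\<^sup>(\<^sup>1\<^sup>)\<close> as \<open>n\<close> tends to infinity:\<close>

definition near_linear :: "(nat \<Rightarrow> real) \<Rightarrow> bool" where
  "near_linear f \<longleftrightarrow>
     (\<exists>\<epsilon> :: nat \<Rightarrow> real. \<epsilon> \<in> o(\<lambda>_. 1) \<and>
        (\<forall>\<^sub>F n in sequentially. f n = real n powr (1 - \<epsilon> n)))"

end

theory Submission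
  imports Defs "HOL-Real_Asymp.Real_Asymp"
begin

text \<open>
  A simple \<open>2 \<times> k\<close> matrix has at most one all-one and at most one all-zero column. Cut the columns of
  \<open>A\<close> into constantly many blocks and suppose there is no large homogeneous submatrix. Inside a block,
  a row whose 0-entries fill a positive proportion of the columns contains few other rows (as sets of
  1-entries), for otherwise those rows vanish on its 0-entries; rows with many 1-entries are treated
  dually. So in each block inclusion is an order with small down-sets, and constantly many such orders
  leave two sets of \<open>n\<^sup>1\<^sup>-\<^sup>o\<^sup>(\<^sup>1\<^sup>)\<close> rows without any comparabilities between them. A pair of rows from
  these two sets shows the columns \<open>(1,0)\<close> and \<open>(0,1)\<close> in every block, so freeness of \<open>A\<close> only
  restricts where \<open>(1,1)\<close> and \<open>(0,0)\<close> occur. It follows that in some block all such pairs of rows are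
  disjoint, or all their complements are. The unions of the two sets of rows are then disjoint there,
  and one of them misses half of the block.
\<close>

section \<open>Large pairs without comparabilities\<close>

text \<open>Encoding each order as inclusion of sets makes transitivity automatic and lets
  cardinality give the direction of a comparability. Equal sets count as comparable.\<close>

definition incomparable :: "(nat \<Rightarrow> 'i \<Rightarrow> 'b set) \<Rightarrow> nat \<Rightarrow> 'i \<Rightarrow> 'i \<Rightarrow> bool" where
  "incomparable E t x y \<longleftrightarrow> (\<forall>j<t. \<not> E j x \<subseteq> E j y \<and> \<not> E j y \<subseteq> E j x)"

definition small_downsets :: "(nat \<Rightarrow> 'i \<Rightarrow> 'b set) \<Rightarrow> nat \<Rightarrow> 'i set \<Rightarrow> real \<Rightarrow> bool" where
  "small_downsets E t V h \<longleftrightarrow> finite V \<and>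
     (\<forall>j<t. \<forall>x\<in>V. finite (E j x) \<and> real (card {y\<in>V. E j y \<subseteq> E j x}) < h)"

text \<open>The parameter \<open>d\<close> is the factor lost in passing from \<open>V\<close> to the pair \<open>A\<close>, \<open>B\<close>.\<close>

definition pair_loss :: "('i \<times> 'b) itself \<Rightarrow> nat \<Rightarrow> nat \<Rightarrow> real \<Rightarrow> bool" where
  "pair_loss T t n d \<longleftrightarrow>
     (\<forall>(E :: nat \<Rightarrow> 'i \<Rightarrow> 'b set) V h.
        small_downsets E t V h \<and> card V \<le> n \<and> 0 < h \<and> h * d \<le> real (card V) \<longrightarrow>
        (\<exists>A B. A \<subseteq> V \<and> B \<subseteq> V \<and> h \<le> real (card A) \<and> h \<le> real (card B) \<and>
           (\<forall>x\<in>A. \<forall>y\<in>B. incomparable E t x y)))"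

lemma incomparable_sym: "incomparable E t x y \<Longrightarrow> incomparable E t y x"
  by (auto simp: incomparable_def)

lemma small_downsets_mono:
  assumes "small_downsets E t V h" "W \<subseteq> V" "t' \<le> t" "h \<le> h'"
  shows "small_downsets E t' W h'"
  unfolding small_downsets_def
proof (intro conjI allI impI ballI)
  show "finite W"
    using assms by (auto simp: small_downsets_def intro: finite_subset)
  fix j x assume j: "j < t'" and x: "x \<in> W"
  then show "finite (E j x)"
    using assms by (auto simp: small_downsets_def)
  have "card {y\<in>W. E j y \<subseteq> E j x} \<le> card {y\<in>V. E j y \<subseteq> E j x}"
    using assms by (intro card_mono) (auto simp: small_downsets_def)
  moreover have "real (card {y\<in>V. E j y \<subseteq> E j x}) < h"
    using assms j x by (auto simp: small_downsets_def)
  ultimately show "real (card {y\<in>W. E j y \<subseteq> E j x}) < h'"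
    using assms(4) by linarith
qed

text \<open>Split off one class at a time: \<open>A\<close> becomes a class and the next split takes
  place inside \<open>B\<close>. Each of the \<open>L\<close> splits costs a factor
  \<open>d\<close>, so with \<open>L\<close> splits still to come the pair is requested of size
  \<open>h * d ^ L\<close>.\<close>

lemma multipartite_from_pairs:
  fixes E :: "nat \<Rightarrow> 'i \<Rightarrow> 'b set"
  assumes pl: "pair_loss TYPE('i \<times> 'b) t n d" and d: "1 \<le> d"
    and V: "small_downsets E t V h" "card V \<le> n" "0 < h" "h * d ^ L \<le> real (card V)"
  shows "\<exists>C. (\<forall>k\<le>L. C k \<subseteq> V \<and> h \<le> real (card (C k))) \<and>
    (\<forall>k\<le>L. \<forall>l\<le>L. k \<noteq> l \<longrightarrow> (\<forall>x\<in>C k. \<forall>y\<in>C l. incomparable E t x y))"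
  using V
proof (induction L arbitrary: V)
  case 0
  then show ?case by (intro exI[of _ "\<lambda>_. V"]) auto
next
  case (Suc L)
  have fin: "finite V" using Suc.prems by (auto simp: small_downsets_def)
  have le: "h \<le> h * d ^ L"
    using Suc.prems(3) d by (simp add: one_le_power)
  have "small_downsets E t V (h * d ^ L)"
    using small_downsets_mono[OF Suc.prems(1)] le by blast
  moreover have "0 < h * d ^ L" using le Suc.prems(3) by linarith
  moreover have "h * d ^ L * d \<le> card V" using Suc.prems(4) by (simp add: mult_ac)
  ultimately have "\<exists>A B. A \<subseteq> V \<and> B \<subseteq> V \<and> h * d ^ L \<le> real (card A) \<and>
      h * d ^ L \<le> real (card B) \<and> (\<forall>x\<in>A. \<forall>y\<in>B. incomparable E t x y)"
    using pl Suc.prems(2) unfolding pair_loss_def by simp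
  then obtain A B where AB: "A \<subseteq> V" "B \<subseteq> V" "h * d ^ L \<le> real (card A)"
      "h * d ^ L \<le> real (card B)" "\<forall>x\<in>A. \<forall>y\<in>B. incomparable E t x y"
    by (elim exE conjE)
  have "small_downsets E t B h" using small_downsets_mono[OF Suc.prems(1) AB(2)] by blast
  moreover have "card B \<le> n" using card_mono[OF fin AB(2)] Suc.prems(2) by linarith
  ultimately have "\<exists>C. (\<forall>k\<le>L. C k \<subseteq> B \<and> h \<le> real (card (C k))) \<and>
    (\<forall>k\<le>L. \<forall>l\<le>L. k \<noteq> l \<longrightarrow> (\<forall>x\<in>C k. \<forall>y\<in>C l. incomparable E t x y))"
    by (rule Suc.IH) (use Suc.prems(3) AB(4) in auto)
  then obtain C where C: "\<forall>k\<le>L. C k \<subseteq> B \<and> h \<le> real (card (C k))"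
     "\<forall>k\<le>L. \<forall>l\<le>L. k \<noteq> l \<longrightarrow> (\<forall>x\<in>C k. \<forall>y\<in>C l. incomparable E t x y)"
    by (elim exE conjE)
  have CB: "C k \<subseteq> B" if "k \<le> L" for k
    using C(1) that by simp
  let ?C = "case_nat A C"
  have "?C k \<subseteq> V \<and> h \<le> real (card (?C k))" if "k \<le> Suc L" for k
  proof (cases k)
    case 0
    then show ?thesis using AB(1,3) le by simp
  next
    case (Suc k')
    then have "k' \<le> L" using that by simp
    then have "C k' \<subseteq> V" "h \<le> real (card (C k'))"
      using C(1) AB(2) by blast+
    then show ?thesis using Suc by simp
  qed
  moreover have "incomparable E t x y"
    if "k \<le> Suc L" "l \<le> Suc L" "k \<noteq> l" "x \<in> ?C k" "y \<in> ?C l" for k l x y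
  proof (cases k)
    case 0
    then have "l \<noteq> 0" using that(3) by simp
    then obtain l' where l': "l = Suc l'" by (rule not0_implies_Suc[THEN exE])
    with that 0 have "x \<in> A" "y \<in> B" using CB[of l'] by auto
    then show ?thesis using AB(5) by blast
  next
    case k: (Suc k')
    show ?thesis
    proof (cases l)
      case 0
      with that k have "y \<in> A" "x \<in> B" using CB[of k'] by auto
      then have "incomparable E t y x" using AB(5) by simp
      then show ?thesis by (rule incomparable_sym)
    next
      case (Suc l')
      then show ?thesis using that k C(2)[rule_format, of k' l' x y] by simp
    qed
  qed
  ultimately show ?case by (intro exI[of _ ?C] conjI allI impI ballI) simp_all
qed

text \<open>Greedy selection: the set that collects \<open>b\<close> points at the lowest weight
  gives these low points as the first class. Every other set has fewer than \<open>b\<close> points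
  strictly below that weight and discards them, so \<open>m * b\<close> points per set
  suffice.\<close>

lemma sorted_subfamily:
  fixes w :: "'i \<Rightarrow> nat" and C :: "nat \<Rightarrow> 'i set" and b :: real
  assumes "finite S" "card S = m" "\<And>s. s \<in> S \<Longrightarrow> finite (C s)" "0 < b"
    and "\<And>s. s \<in> S \<Longrightarrow> real m * b \<le> real (card (C s))"
    and "\<And>s s' x y. s \<in> S \<Longrightarrow> s' \<in> S \<Longrightarrow> s \<noteq> s' \<Longrightarrow> x \<in> C s \<Longrightarrow> y \<in> C s' \<Longrightarrow> Q x y"
  shows "\<exists>B. (\<forall>k<m. B k \<subseteq> (\<Union>s\<in>S. C s) \<and> b \<le> real (card (B k))) \<and>
    (\<forall>k l. k < l \<and> l < m \<longrightarrow> (\<forall>x\<in>B k. \<forall>y\<in>B l. w x \<le> w y \<and> Q x y))"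
  using assms
proof (induction m arbitrary: S C)
  case 0
  then show ?case by auto
next
  case (Suc m)
  define \<theta> where "\<theta> s = (LEAST v. b \<le> real (card {x\<in>C s. w x \<le> v}))" for s
  have \<theta>1: "b \<le> real (card {x\<in>C s. w x \<le> \<theta> s})" if s: "s \<in> S" for s
    unfolding \<theta>_def
  proof (rule LeastI_ex)
    have "{x\<in>C s. w x \<le> Max (w ` C s)} = C s"
      using Suc.prems(3)[OF s] by auto
    moreover have "b \<le> real (Suc m) * b" using Suc.prems(4) by simp
    ultimately have "b \<le> real (card {x\<in>C s. w x \<le> Max (w ` C s)})"
      using Suc.prems(5)[OF s] by simp
    then show "\<exists>v. b \<le> real (card {x\<in>C s. w x \<le> v})" by blast
  qed
  have \<theta>2: "real (card {x\<in>C s. w x < v}) < b" if s: "s \<in> S" and v: "v \<le> \<theta> s" for s v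
  proof (cases v)
    case 0
    then show ?thesis using Suc.prems(4) by simp
  next
    case (Suc u)
    then have "\<not> b \<le> real (card {x\<in>C s. w x \<le> u})"
      using v not_less_Least[of u "\<lambda>v. b \<le> real (card {x\<in>C s. w x \<le> v})"] by (simp add: \<theta>_def)
    then show ?thesis using Suc by (simp add: less_Suc_eq_le)
  qed
  have "S \<noteq> {}" using Suc.prems(2) by auto
  then obtain s where s: "s \<in> S" and min: "\<And>s'. s' \<in> S \<Longrightarrow> \<theta> s \<le> \<theta> s'"
    using arg_min_if_finite[OF Suc.prems(1), of \<theta>] by (metis not_le_imp_less)
  define D where "D s' = {x\<in>C s'. \<theta> s \<le> w x}" for s'
  have D: "real m * b \<le> real (card (D s'))" if s': "s' \<in> S - {s}" for s'
  proof -
    have "C s' = {x\<in>C s'. w x < \<theta> s} \<union> D s'" by (auto simp: D_def)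
    then have "card (C s') \<le> card {x\<in>C s'. w x < \<theta> s} + card (D s')"
      by (metis card_Un_le)
    moreover have "real (card {x\<in>C s'. w x < \<theta> s}) < b"
      using \<theta>2 s' min by auto
    moreover have "real m * b + b \<le> real (card (C s'))"
      using Suc.prems(5)[of s'] s' by (simp add: algebra_simps)
    ultimately show ?thesis by linarith
  qed
  have "\<exists>B. (\<forall>k<m. B k \<subseteq> (\<Union>s'\<in>S-{s}. D s') \<and> b \<le> real (card (B k))) \<and>
    (\<forall>k l. k < l \<and> l < m \<longrightarrow> (\<forall>x\<in>B k. \<forall>y\<in>B l. w x \<le> w y \<and> Q x y))"
  proof (rule Suc.IH)
    show "card (S - {s}) = m" using Suc.prems(1,2) s by simp
    show "Q x y" if "u \<in> S - {s}" "v \<in> S - {s}" "u \<noteq> v" "x \<in> D u" "y \<in> D v" for u v x y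
      using Suc.prems(6)[of u v x y] that by (auto simp: D_def)
  qed (use Suc.prems D in \<open>auto simp: D_def\<close>)
  then obtain B where B: "\<forall>k<m. B k \<subseteq> (\<Union>s'\<in>S-{s}. D s') \<and> b \<le> real (card (B k))"
    "\<forall>k l. k < l \<and> l < m \<longrightarrow> (\<forall>x\<in>B k. \<forall>y\<in>B l. w x \<le> w y \<and> Q x y)" by blast
  let ?B = "case_nat {x\<in>C s. w x \<le> \<theta> s} B"
  have "?B k \<subseteq> (\<Union>s\<in>S. C s) \<and> b \<le> real (card (?B k))" if "k < Suc m" for k
  proof (cases k)
    case 0
    then show ?thesis using \<theta>1[OF s] s by auto
  next
    case k: (Suc k')
    then have "B k' \<subseteq> (\<Union>s'\<in>S-{s}. D s')" "b \<le> real (card (B k'))" using that B(1) by auto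
    then show ?thesis using k by (fastforce simp: D_def)
  qed
  moreover have "w x \<le> w y \<and> Q x y"
    if kl: "k < l" "l < Suc m" and xy: "x \<in> ?B k" "y \<in> ?B l" for k l x y
  proof -
    obtain l' where l: "l = Suc l'" using kl by (cases l) auto
    show ?thesis
    proof (cases k)
      case 0
      then have x: "x \<in> C s" "w x \<le> \<theta> s" using xy by auto
      have "y \<in> B l'" "l' < m" using xy l kl by auto
      then obtain s' where "s' \<in> S - {s}" "y \<in> D s'" using B(1) by blast
      then show ?thesis using x Suc.prems(6)[of s s' x y] s by (auto simp: D_def)
    next
      case (Suc k')
      then show ?thesis using kl xy l B(2) by auto
    qed
  qed
  ultimately show ?case by (intro exI[of _ ?B]) blast
qed

text \<open>Cut \<open>X\<close> into at most \<open>q\<close> pieces of at most \<open>s\<close>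
  points. Cardinality of unions is subadditive, so the best piece accounts for a \<open>q\<close>-th
  of the whole union.\<close>

lemma subset_large_union:
  fixes D :: "'a \<Rightarrow> 'b set"
  assumes "finite X" "card X \<le> q * s" "\<And>x. x \<in> X \<Longrightarrow> finite (D x)"
  shows "\<exists>Y\<subseteq>X. card Y \<le> s \<and> card (\<Union>x\<in>X. D x) \<le> q * card (\<Union>x\<in>Y. D x)"
  using assms
proof (induction q arbitrary: X)
  case 0
  then show ?case by auto
next
  case (Suc q)
  obtain Y where Y: "Y \<subseteq> X" "card Y = min s (card X)"
    using obtain_subset_with_card_n[of "min s (card X)" X] by (metis min.cobounded2)
  have "card (X - Y) \<le> q * s"
    using Y Suc.prems(1,2) card_Diff_subset[OF finite_subset[OF Y(1)] Y(1)] by (auto simp: min_def)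
  moreover have "finite (X - Y)" "\<And>x. x \<in> X - Y \<Longrightarrow> finite (D x)"
    using Suc.prems by auto
  ultimately obtain Z where Z: "Z \<subseteq> X - Y" "card Z \<le> s"
      "card (\<Union>x\<in>X-Y. D x) \<le> q * card (\<Union>x\<in>Z. D x)"
    using Suc.IH[of "X - Y"] by blast
  have "(\<Union>x\<in>X. D x) = (\<Union>x\<in>Y. D x) \<union> (\<Union>x\<in>X-Y. D x)" using Y by auto
  then have "card (\<Union>x\<in>X. D x) \<le> card (\<Union>x\<in>Y. D x) + card (\<Union>x\<in>X-Y. D x)"
    by (metis card_Un_le)
  also note Z(3)
  finally have *: "card (\<Union>x\<in>X. D x) \<le> card (\<Union>x\<in>Y. D x) + q * card (\<Union>x\<in>Z. D x)" by simp
  show ?case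
  proof (cases "card (\<Union>x\<in>Z. D x) \<le> card (\<Union>x\<in>Y. D x)")
    case True
    then have "q * card (\<Union>x\<in>Z. D x) \<le> q * card (\<Union>x\<in>Y. D x)" by (rule mult_le_mono2)
    with * have "card (\<Union>x\<in>X. D x) \<le> Suc q * card (\<Union>x\<in>Y. D x)"
      unfolding mult_Suc by linarith
    then show ?thesis using Y by auto
  next
    case False
    with * have "card (\<Union>x\<in>X. D x) \<le> Suc q * card (\<Union>x\<in>Z. D x)" by simp
    then show ?thesis using Z by auto
  qed
qed

text \<open>
  If consecutive sets admit no large pair without relations, a set \<open>X\<close> in the top set with at least
  \<open>h\<close> elements below it at one level has almost everything below it at the next level, so one of \<open>q\<close>
  pieces of \<open>X\<close> still has \<open>h\<close> elements below it. After \<open>L\<close> levels \<open>X\<close> is a single point.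
\<close>

lemma chain_large_downset:
  fixes R :: "'i \<Rightarrow> 'i \<Rightarrow> bool" and h :: real
  assumes refl: "\<And>x. R x x" and trans: "\<And>x y z. R x y \<Longrightarrow> R y z \<Longrightarrow> R x z"
    and B: "\<And>k. k \<le> L \<Longrightarrow> finite (B k) \<and> h * real (q + 1) \<le> real (card (B k))"
    and top: "card (B L) \<le> q ^ L" and q: "0 < q" and h: "0 < h"
    and dense: "\<And>k X Y. k < L \<Longrightarrow> X \<subseteq> B k \<Longrightarrow> Y \<subseteq> B (Suc k) \<Longrightarrow> h \<le> real (card X) \<Longrightarrow>
      h \<le> real (card Y) \<Longrightarrow> \<exists>x\<in>X. \<exists>y\<in>Y. R x y"
  shows "\<exists>x\<in>B L. h \<le> real (card {y\<in>B 0. R y x})"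
proof -
  have *: "\<exists>X\<subseteq>B L. card X \<le> q ^ (L - k) \<and> h \<le> real (card (\<Union>x\<in>X. {y\<in>B (L - k). R y x}))"
    if "k \<le> L" for k
    using that
  proof (induction k)
    case 0
    have "B L \<subseteq> (\<Union>x\<in>B L. {y\<in>B L. R y x})" using refl by blast
    then have "card (B L) \<le> card (\<Union>x\<in>B L. {y\<in>B L. R y x})"
      using B[of L] by (intro card_mono) auto
    moreover have "h * 1 \<le> h * real (q + 1)" using h q by (intro mult_left_mono) auto
    then have "h \<le> real (card (B L))" using B[of L] by simp
    ultimately show ?case using top by (intro exI[of _ "B L"]) auto
  next
    case (Suc k)
    define k' where "k' = L - Suc k"
    have k': "L - k = Suc k'" "k' < L" using Suc.prems by (auto simp: k'_def)
    obtain X where X: "X \<subseteq> B L" "card X \<le> q ^ Suc k'"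
      "h \<le> real (card (\<Union>x\<in>X. {y\<in>B (Suc k'). R y x}))"
      using Suc k' by auto
    have finX: "finite X" using X(1) B[of L] finite_subset by blast
    let ?D = "\<lambda>x. {y\<in>B k'. R y x}"
    \<comment> \<open>\<open>W\<close> consists of the points of level \<open>k'\<close> below
      nothing in \<open>X\<close>. By transitivity they are not below any of the at least
      \<open>h\<close> points that lie below \<open>X\<close> one level up, so density leaves fewer
      than \<open>h\<close> of them.\<close>
    define W where "W = B k' - (\<Union>x\<in>X. ?D x)"
    have finB: "finite (B k')" using B[of k'] k' by simp
    have "real (card W) < h"
    proof (rule ccontr)
      assume "\<not> real (card W) < h"
      then have "\<exists>x\<in>W. \<exists>y\<in>(\<Union>x\<in>X. {y\<in>B (Suc k'). R y x}). R x y"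
        by (intro dense[OF k'(2)]) (use X in \<open>auto simp: W_def\<close>)
      then show False using trans by (auto simp: W_def)
    qed
    moreover have "card W = card (B k') - card (\<Union>x\<in>X. ?D x)"
      unfolding W_def using finB by (intro card_Diff_subset) (auto intro: finite_subset)
    moreover have "card (\<Union>x\<in>X. ?D x) \<le> card (B k')"
      using finB by (intro card_mono) auto
    ultimately have 1: "h * real q \<le> real (card (\<Union>x\<in>X. ?D x))"
      using B[of k'] k'(2) by (simp add: algebra_simps of_nat_diff)
    have "card X \<le> q * q ^ k'" using X(2) by simp
    then have "\<exists>Y\<subseteq>X. card Y \<le> q ^ k' \<and> card (\<Union>x\<in>X. ?D x) \<le> q * card (\<Union>x\<in>Y. ?D x)"
      by (rule subset_large_union[OF finX]) (use finB in simp)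
    then obtain Y where Y: "Y \<subseteq> X" "card Y \<le> q ^ k'"
      "card (\<Union>x\<in>X. ?D x) \<le> q * card (\<Union>x\<in>Y. ?D x)"
      by (elim exE conjE)
    have "real (card (\<Union>x\<in>X. ?D x)) \<le> real (q * card (\<Union>x\<in>Y. ?D x))"
      using Y(3) by (rule of_nat_mono)
    then have "real q * h \<le> real q * real (card (\<Union>x\<in>Y. ?D x))"
      using 1 by (simp only: of_nat_mult mult.commute[of h])
    then have "h \<le> real (card (\<Union>x\<in>Y. ?D x))" using q by simp
    moreover have "Y \<subseteq> B L" using Y(1) X(1) by (rule subset_trans)
    ultimately show ?case using Y(2) unfolding k'_def by (intro exI[of _ Y] conjI)
  qed
  obtain X where X: "X \<subseteq> B L" "card X \<le> 1" "h \<le> real (card (\<Union>x\<in>X. {y\<in>B 0. R y x}))"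
    using *[of L] by auto
  have "X \<noteq> {}" using X(3) h by auto
  moreover have "finite X" using X(1) B[of L] finite_subset by blast
  ultimately have "card X = 1" using X(2) by (simp add: card_gt_0_iff le_antisym Suc_le_eq)
  then obtain x where "X = {x}" using card_1_singletonE by blast
  then show ?thesis using X by auto
qed

text \<open>Take \<open>L + 1\<close> classes incomparable in the first \<open>t\<close> orders,
  sorted by cardinality in the new one. If no pair works, large subsets of consecutive classes
  always contain an inclusion, and \<open>chain_large_downset\<close> yields a forbidden downset of
  size \<open>h\<close>. The loss is \<open>d ^ L\<close> for the classes, \<open>Suc L\<close> for
  sorting and \<open>q + 1\<close> for the chain.\<close>

lemma pair_loss_Suc:
  assumes pl: "pair_loss TYPE('i \<times> 'b) t n d" and d: "1 \<le> d" and q: "n \<le> q ^ L" "0 < q"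
  shows "pair_loss TYPE('i \<times> 'b) (Suc t) n (d ^ L * real (Suc L) * real (q + 1))"
  unfolding pair_loss_def
proof (intro allI impI, elim conjE)
  fix E :: "nat \<Rightarrow> 'i \<Rightarrow> 'b set" and V and h :: real
  assume sd: "small_downsets E (Suc t) V h" and n: "card V \<le> n" and h: "0 < h"
    and V: "h * (d ^ L * real (Suc L) * real (q + 1)) \<le> real (card V)"
  have fin: "finite V" using sd by (simp add: small_downsets_def)
  define h0 where "h0 = real (Suc L) * (h * real (q + 1))"
  have "h * 1 \<le> h * (real (Suc L) * real (q + 1))"
    using h q mult_mono[of 1 "real (Suc L)" 1 "real (q + 1)"] by (intro mult_left_mono) auto
  then have h0: "h \<le> h0" by (simp add: h0_def mult_ac)
  have "\<exists>C. (\<forall>k\<le>L. C k \<subseteq> V \<and> h0 \<le> real (card (C k))) \<and>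
    (\<forall>k\<le>L. \<forall>l\<le>L. k \<noteq> l \<longrightarrow> (\<forall>x\<in>C k. \<forall>y\<in>C l. incomparable E t x y))"
  proof (rule multipartite_from_pairs[OF pl d])
    show "small_downsets E t V h0" using small_downsets_mono[OF sd] h0 by simp
    show "h0 * d ^ L \<le> real (card V)" using V by (simp add: h0_def mult_ac)
  qed (use n h h0 in auto)
  then obtain C where C: "\<forall>k\<le>L. C k \<subseteq> V \<and> h0 \<le> real (card (C k))"
    "\<forall>k\<le>L. \<forall>l\<le>L. k \<noteq> l \<longrightarrow> (\<forall>x\<in>C k. \<forall>y\<in>C l. incomparable E t x y)"
    by (elim exE conjE)
  \<comment> \<open>Ordering by cardinality, comparable sets are always included forwards.\<close>
  let ?w = "\<lambda>x. card (E t x)"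
  have "\<exists>B. (\<forall>k<Suc L. B k \<subseteq> (\<Union>s\<in>{..L}. C s) \<and> h * real (q + 1) \<le> real (card (B k))) \<and>
    (\<forall>k l. k < l \<and> l < Suc L \<longrightarrow> (\<forall>x\<in>B k. \<forall>y\<in>B l. ?w x \<le> ?w y \<and> incomparable E t x y))"
  proof (rule sorted_subfamily)
    show "finite (C s)" if "s \<in> {..L}" for s
      using that C(1) fin finite_subset by (metis atMost_iff)
    show "real (Suc L) * (h * real (q + 1)) \<le> real (card (C s))" if "s \<in> {..L}" for s
      using that C(1) by (simp add: h0_def)
    show "incomparable E t x y" if "s \<in> {..L}" "s' \<in> {..L}" "s \<noteq> s'" "x \<in> C s" "y \<in> C s'" for s s' x y
      using that C(2) by simp
  qed (use h q in auto)
  then obtain B where B': "\<forall>k<Suc L. B k \<subseteq> (\<Union>s\<in>{..L}. C s) \<and> h * real (q + 1) \<le> real (card (B k))"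
    and w: "\<forall>k l. k < l \<and> l < Suc L \<longrightarrow> (\<forall>x\<in>B k. \<forall>y\<in>B l. ?w x \<le> ?w y \<and> incomparable E t x y)"
    by (elim exE conjE)
  have B: "B k \<subseteq> (\<Union>s\<in>{..L}. C s) \<and> h * real (q + 1) \<le> real (card (B k))" if "k \<le> L" for k
    using B' that by (simp add: less_Suc_eq_le)
  have CV: "(\<Union>s\<in>{..L}. C s) \<subseteq> V" using C(1) by (intro UN_least) simp
  have BV: "B k \<subseteq> V" if "k \<le> L" for k using B[OF that] CV by (meson subset_trans)
  show "\<exists>A B. A \<subseteq> V \<and> B \<subseteq> V \<and> h \<le> real (card A) \<and> h \<le> real (card B) \<and>
           (\<forall>x\<in>A. \<forall>y\<in>B. incomparable E (Suc t) x y)"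
  proof (rule ccontr)
    assume no: "\<not> ?thesis"
    have "\<exists>x\<in>B L. h \<le> real (card {y\<in>B 0. E t y \<subseteq> E t x})"
    proof (rule chain_large_downset[where q = q])
      fix k X Y assume k: "k < L" and XY: "X \<subseteq> B k" "Y \<subseteq> B (Suc k)" "h \<le> real (card X)" "h \<le> real (card Y)"
      have "X \<subseteq> V" "Y \<subseteq> V" using XY k BV[of k] BV[of "Suc k"] by auto
      then obtain x y where xy: "x \<in> X" "y \<in> Y" "\<not> incomparable E (Suc t) x y"
        using no XY by blast
      have *: "?w x \<le> ?w y" "incomparable E t x y"
        using w[rule_format, of k "Suc k" x y] subsetD[OF XY(1) xy(1)] subsetD[OF XY(2) xy(2)] k
        by simp_all
      then have "E t x \<subseteq> E t y \<or> E t y \<subseteq> E t x"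
        using xy(3) by (auto simp: incomparable_def less_Suc_eq)
      moreover have "finite (E t x)"
        using sd xy \<open>X \<subseteq> V\<close> by (auto simp: small_downsets_def)
      ultimately have "E t x \<subseteq> E t y" using *(1) card_seteq by blast
      then show "\<exists>x\<in>X. \<exists>y\<in>Y. E t x \<subseteq> E t y" using xy by blast
    next
      show "card (B L) \<le> q ^ L" using card_mono[OF fin BV[of L]] n q by simp
      show "finite (B k) \<and> h * real (q + 1) \<le> real (card (B k))" if "k \<le> L" for k
        using B[OF that] finite_subset[OF BV[OF that] fin] by blast
    qed (use q h in auto)
    then obtain x where x: "x \<in> B L" "h \<le> real (card {y\<in>B 0. E t y \<subseteq> E t x})" by blast
    have "card {y\<in>B 0. E t y \<subseteq> E t x} \<le> card {y\<in>V. E t y \<subseteq> E t x}"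
      using BV[of 0] fin by (intro card_mono) auto
    moreover have "real (card {y\<in>V. E t y \<subseteq> E t x}) < h"
      using sd x(1) BV[of L] by (auto simp: small_downsets_def)
    ultimately show False using x(2) by linarith
  qed
qed

section \<open>Constantly many orders cost a subpolynomial factor\<close>

lemma pair_loss_0: "pair_loss TYPE('i \<times> 'b) 0 n 1"
  unfolding pair_loss_def
proof (intro allI impI)
  fix E :: "nat \<Rightarrow> 'i \<Rightarrow> 'b set" and V h
  assume "small_downsets E 0 V h \<and> card V \<le> n \<and> 0 < h \<and> h * 1 \<le> real (card V)"
  then show "\<exists>A B. A \<subseteq> V \<and> B \<subseteq> V \<and> h \<le> real (card A) \<and> h \<le> real (card B) \<and>
      (\<forall>x\<in>A. \<forall>y\<in>B. incomparable E 0 x y)"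
    by (intro exI[of _ V]) (simp add: incomparable_def)
qed

text \<open>With \<open>q\<close> about \<open>n powr (\<epsilon> / 2)\<close> and a constant
  \<open>L\<close> of at least \<open>2 / \<epsilon>\<close>, \<open>n \<le> q ^ L\<close> holds.
  Since \<open>L\<close> does not depend on \<open>n\<close>, the induction hypothesis can be used
  with \<open>\<delta>\<close> so small that \<open>d ^ L\<close> is at most
  \<open>n powr (\<epsilon> / 4)\<close>; the remaining quarter of \<open>\<epsilon>\<close> absorbs
  the constants.\<close>

lemma pair_loss_subpolynomial:
  assumes "0 < \<epsilon>"
  shows "\<forall>\<^sub>F n in sequentially. \<exists>d. 1 \<le> d \<and> d \<le> real n powr \<epsilon> \<and> pair_loss TYPE('i \<times> 'b) t n d"
  using assms
proof (induction t arbitrary: \<epsilon>)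
  case 0
  have "\<forall>\<^sub>F n in sequentially. 1 \<le> real n powr \<epsilon>"
    using 0 by real_asymp
  then show ?case by eventually_elim (use pair_loss_0 in blast)
next
  case (Suc t)
  define L where "L = nat \<lceil>2 / \<epsilon>\<rceil>"
  have L: "2 / \<epsilon> \<le> real L" unfolding L_def by linarith
  then have L': "1 \<le> \<epsilon> / 2 * real L" using Suc.prems by (simp add: field_simps)
  define \<delta> where "\<delta> = \<epsilon> / (4 * real (Suc L))"
  have \<delta>: "0 < \<delta>" and \<delta>L: "\<delta> * real L \<le> \<epsilon> / 4"
    using Suc.prems by (auto simp: \<delta>_def field_simps)
  have "\<forall>\<^sub>F n in sequentially.
      real n powr (\<epsilon> / 4) * real (Suc L) * (real n powr (\<epsilon> / 2) + 2) \<le> real n powr \<epsilon>"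
    using Suc.prems by real_asymp
  then show ?case
    using Suc.IH[OF \<delta>] eventually_ge_at_top[of 1]
  proof eventually_elim
    case (elim n)
    then obtain d where d: "1 \<le> d" "d \<le> real n powr \<delta>" "pair_loss TYPE('i \<times> 'b) t n d" by blast
    have n: "1 \<le> real n" using elim(3) by simp
    define q where "q = nat \<lceil>real n powr (\<epsilon> / 2)\<rceil>"
    have q: "real n powr (\<epsilon> / 2) \<le> real q" "real q \<le> real n powr (\<epsilon> / 2) + 1"
      unfolding q_def using ceiling_correct[of "real n powr (\<epsilon> / 2)"]
      by (simp_all add: of_nat_nat)
    have "0 < real n powr (\<epsilon> / 2)" using n by simp
    then have q0: "0 < q" using q by linarith
    have "real n = real n powr 1" using n by simp
    also have "\<dots> \<le> real n powr (\<epsilon> / 2 * real L)" using n L' by (intro powr_mono)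
    also have "\<dots> = (real n powr (\<epsilon> / 2)) ^ L" using n by (simp add: powr_power mult.commute)
    also have "\<dots> \<le> real q ^ L" using q(1) by (intro power_mono) auto
    finally have "real n \<le> real (q ^ L)" by simp
    then have nq: "n \<le> q ^ L" by (simp only: of_nat_le_iff)
    let ?d = "d ^ L * real (Suc L) * real (q + 1)"
    have "d ^ L \<le> (real n powr \<delta>) ^ L" using d by (intro power_mono) auto
    also have "\<dots> = real n powr (\<delta> * real L)" using n by (simp add: powr_power mult.commute)
    also have "\<dots> \<le> real n powr (\<epsilon> / 4)" using n \<delta>L by (intro powr_mono)
    finally have "d ^ L \<le> real n powr (\<epsilon> / 4)" .
    then have "?d \<le> real n powr (\<epsilon> / 4) * real (Suc L) * (real n powr (\<epsilon> / 2) + 2)"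
      using q(2) d(1) by (intro mult_mono) auto
    also note elim(1)
    finally have "?d \<le> real n powr \<epsilon>" .
    moreover have "1 * 1 * 1 \<le> ?d"
      using d(1) by (intro mult_mono) (auto intro: one_le_power)
    ultimately show ?case
      using pair_loss_Suc[OF d(3,1) nq q0] by (intro exI[of _ ?d]) simp
  qed
qed

section \<open>Patterns and blocks of columns\<close>

text \<open>
  Column \<open>x\<close> of the pattern is placed in block \<open>\<beta> x\<close>, with the two special columns \<open>x1\<close> and \<open>x2\<close>
  (which may lie outside the pattern) sent to the blocks \<open>u\<close> and \<open>v\<close>.
\<close>

lemma pattern_from_blocks:
  fixes r0 r1 p0 p1 :: "nat \<Rightarrow> bool" and z :: bool
  assumes x: "x1 < x2" "x1 \<le> u" "u + (x2 - x1) \<le> v" "v + k < T"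
    and ab: "\<And>b. b < T \<Longrightarrow> \<exists>c\<in>{b*w..<Suc b*w}. r0 c = z \<and> r1 c \<noteq> z"
            "\<And>b. b < T \<Longrightarrow> \<exists>c\<in>{b*w..<Suc b*w}. r0 c \<noteq> z \<and> r1 c = z"
    and u: "\<exists>c\<in>{u*w..<Suc u*w}. r0 c = z \<and> r1 c = z"
    and v: "\<exists>c\<in>{v*w..<Suc v*w}. r0 c \<noteq> z \<and> r1 c \<noteq> z"
    and p: "\<And>x. x < k \<Longrightarrow> p0 x = z \<Longrightarrow> p1 x = z \<Longrightarrow> x = x1"
           "\<And>x. x < k \<Longrightarrow> p0 x \<noteq> z \<Longrightarrow> p1 x \<noteq> z \<Longrightarrow> x = x2"
  shows "\<exists>s. strict_mono_on {..<k} s \<and> s ` {..<k} \<subseteq> {..<T*w} \<and>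
     (\<forall>x<k. r0 (s x) = p0 x \<and> r1 (s x) = p1 x)"
proof -
  \<comment> \<open>Columns up to \<open>x1\<close> take consecutive blocks ending at
    \<open>u\<close>, those between the special columns the blocks right after \<open>u\<close>, and
    those from \<open>x2\<close> on the blocks from \<open>v\<close>. By \<open>x1 \<le> u\<close>
    the subtractions never truncate.\<close>
  define \<beta> where "\<beta> x = (if x \<le> x1 then u - (x1 - x) else if x < x2 then u + (x - x1) else v + (x - x2))" for x
  have \<beta>_mono: "\<beta> x < \<beta> y" if "x < y" for x y
    using that x by (auto simp: \<beta>_def)
  have \<beta>_T: "\<beta> x < T" if "x < k" for x
    using that x by (auto simp: \<beta>_def)
  have "\<exists>c\<in>{\<beta> x*w..<Suc (\<beta> x)*w}. r0 c = p0 x \<and> r1 c = p1 x" if "x < k" for x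
  proof (cases "p0 x = z"; cases "p1 x = z")
    assume *: "p0 x = z" "p1 x = z"
    then have "x = x1" using p(1) that by blast
    then have "\<beta> x = u" by (simp add: \<beta>_def)
    then show ?thesis using u * by simp
  next
    assume *: "p0 x \<noteq> z" "p1 x \<noteq> z"
    then have "x = x2" using p(2) that by blast
    then have "\<beta> x = v" using x by (simp add: \<beta>_def)
    then show ?thesis using v * by auto
  next
    assume *: "p0 x = z" "p1 x \<noteq> z"
    then show ?thesis using ab(1)[OF \<beta>_T[OF that]] by auto
  next
    assume *: "p0 x \<noteq> z" "p1 x = z"
    then show ?thesis using ab(2)[OF \<beta>_T[OF that]] by auto
  qed
  then have "\<exists>s. \<forall>x<k. s x \<in> {\<beta> x*w..<Suc (\<beta> x)*w} \<and> r0 (s x) = p0 x \<and> r1 (s x) = p1 x"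
    by (intro choice) blast
  then obtain s where s: "\<And>x. x < k \<Longrightarrow> s x \<in> {\<beta> x*w..<Suc (\<beta> x)*w}"
    "\<And>x. x < k \<Longrightarrow> r0 (s x) = p0 x \<and> r1 (s x) = p1 x"
    by blast
  have "s x < s y" if "x < y" "y < k" for x y
  proof -
    have "s x < Suc (\<beta> x) * w" using s(1)[of x] that by simp
    also have "\<dots> \<le> \<beta> y * w" using \<beta>_mono[OF that(1)] by (intro mult_le_mono1) simp
    also have "\<dots> \<le> s y" using s(1)[of y] that by simp
    finally show ?thesis .
  qed
  then have "strict_mono_on {..<k} s" by (auto intro!: strict_mono_onI)
  moreover have "s x < T * w" if "x < k" for x
  proof -
    have "s x < Suc (\<beta> x) * w" using s(1)[OF that] by simp
    also have "\<dots> \<le> T * w" using \<beta>_T[OF that] by (intro mult_le_mono1) simp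
    finally show ?thesis .
  qed
  ultimately show ?thesis using s(2) by (intro exI[of _ s]) auto
qed

lemma large_fibre:
  assumes "finite X" "f ` X \<subseteq> Y" "finite Y" "X \<noteq> {}"
  shows "\<exists>y\<in>Y. card X \<le> card Y * card {x\<in>X. f x = y}"
proof (rule ccontr)
  assume "\<not> ?thesis"
  then have *: "\<And>y. y \<in> Y \<Longrightarrow> card Y * card {x\<in>X. f x = y} < card X" by auto
  have "card X = (\<Sum>y\<in>Y. card {x\<in>X. f x = y})"
    using sum.group[OF assms(1,3,2), of "\<lambda>_. 1 :: nat"] by simp
  then have "card Y * card X = (\<Sum>y\<in>Y. card Y * card {x\<in>X. f x = y})"
    by (simp add: sum_distrib_left)
  also have "\<dots> < (\<Sum>y\<in>Y. card X)"
    using assms * by (intro sum_strict_mono) auto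
  finally show False by simp
qed

text \<open>
  The blocks \<open>K\<close>, \<open>2 K\<close>, \<open>3 K\<close>, \<open>4 K\<close> are the candidates for the special columns; there is room for
  all other columns of the pattern before, between and after them.
\<close>

lemma homogeneous_rows_from_blocks:
  fixes K k n w s x1 x2 :: nat and M :: "nat \<Rightarrow> nat \<Rightarrow> bool" and p0 p1 :: "nat \<Rightarrow> bool" and z :: bool and h d :: real
  defines "T \<equiv> 5 * K"
  assumes x: "x1 < x2" "x2 < K" "k < K"
    and p: "\<And>x. x < k \<Longrightarrow> p0 x = z \<Longrightarrow> p1 x = z \<Longrightarrow> x = x1"
           "\<And>x. x < k \<Longrightarrow> p0 x \<noteq> z \<Longrightarrow> p1 x \<noteq> z \<Longrightarrow> x = x2"
    and free: "\<And>i j s. i < j \<Longrightarrow> j < n \<Longrightarrow> strict_mono_on {..<k} s \<Longrightarrow> s ` {..<k} \<subseteq> {..<T*w} \<Longrightarrow>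
       \<exists>x<k. M i (s x) \<noteq> p0 x \<or> M j (s x) \<noteq> p1 x"
    and s: "2 * s \<le> w"
    and pl: "pair_loss TYPE(nat \<times> nat) T n d" and h: "0 < h"
    and n: "2 * h * d * 4 ^ T \<le> real n" "0 < n"
  shows "\<exists>R\<subseteq>{..<n}. \<exists>C\<subseteq>{..<T*w}. \<exists>v. h \<le> real (card R) \<and> s \<le> card C \<and> (\<forall>i\<in>R. \<forall>c\<in>C. M i c = v)"
proof (rule ccontr)
  assume "\<not> ?thesis"
  then have no: "real (card R) < h"
    if "R \<subseteq> {..<n}" "C \<subseteq> {..<T*w}" "s \<le> card C" "\<And>i c. i \<in> R \<Longrightarrow> c \<in> C \<Longrightarrow> M i c = v" for R C v
    using that by (metis linorder_not_le)

  \<comment> \<open>Row types and the pair of row sets\<close>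
  define J where "J b = {b*w..<Suc b*w}" for b
  have J: "J b \<subseteq> {..<T*w}" if "b < T" for b
  proof -
    have "Suc b * w \<le> T * w" using that by (intro mult_le_mono1) simp
    then show ?thesis by (auto simp: J_def)
  qed
  have cardJ: "card (J b) = w" and finJ: "finite (J b)" for b by (simp_all add: J_def)
  define S where "S i b = {c\<in>J b. M i c = z}" for i b
  define N where "N i b = {c\<in>J b. M i c \<noteq> z}" for i b
  have SN: "S i b \<union> N i b = J b" "S i b \<inter> N i b = {}" "S i b \<subseteq> J b" "N i b \<subseteq> J b" for i b
    by (auto simp: S_def N_def)
  have fin: "finite (S i b)" "finite (N i b)" for i b
    by (simp_all add: S_def N_def finJ)
  have card_SN: "card (S i b) + card (N i b) = w" for i b
    using card_Un_disjoint[OF fin SN(2)] SN(1) cardJ by simp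
  \<comment> \<open>The type records which of the two values is rare in each block. There are only
    \<open>4 ^ T\<close> types, so one of them keeps a constant fraction of the rows.\<close>
  define \<tau> where "\<tau> i = map (\<lambda>b. (card (S i b) < s, card (N i b) < s)) [0..<T]" for i
  let ?Y = "{ts :: (bool \<times> bool) list. set ts \<subseteq> UNIV \<and> length ts = T}"
  have cardY: "card ?Y = 4 ^ T"
    by (subst card_lists_length_eq) (simp_all add: UNIV_Times_UNIV[symmetric] card_cartesian_product del: UNIV_Times_UNIV)
  have "\<exists>ts\<in>?Y. card {..<n} \<le> card ?Y * card {i\<in>{..<n}. \<tau> i = ts}"
  proof (rule large_fibre)
    show "finite ?Y" by (rule finite_lists_length_eq) simp
  qed (use n in \<open>auto simp: \<tau>_def\<close>)
  then obtain ts where ts: "n \<le> 4 ^ T * card {i\<in>{..<n}. \<tau> i = ts}" unfolding cardY by auto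
  define V where "V = {i\<in>{..<n}. \<tau> i = ts}"
  have Vn: "V \<subseteq> {..<n}" and finV: "finite V" by (auto simp: V_def)
  \<comment> \<open>All rows of \<open>V\<close> are sparse (fewer than \<open>s\<close> entries \<open>z\<close>) in the blocks \<open>sp\<close> and dense (fewer
    than \<open>s\<close> other entries) in the blocks \<open>de\<close>; there may be blocks that are neither.\<close>
  define sp where "sp b = fst (ts ! b)" for b
  define de where "de b = snd (ts ! b)" for b
  have type: "card (S i b) < s \<longleftrightarrow> sp b" "card (N i b) < s \<longleftrightarrow> de b" if "i \<in> V" "b < T" for i b
    using that by (auto simp: V_def \<tau>_def sp_def de_def)
  \<comment> \<open>The complement of \<open>E b x\<close> in the block has at least
    \<open>s\<close> columns: in a dense block because \<open>2 * s \<le> w\<close>, otherwise by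
    the type. Rows whose set lies inside \<open>E b x\<close> are constant there, so there are fewer
    than \<open>h\<close> of them.\<close>
  define E where "E b i = (if de b then N i b else S i b)" for b i
  have below: "real (card {y\<in>V. E b y \<subseteq> E b x}) < h" if b: "b < T" and x: "x \<in> V" for b x
  proof (cases "de b")
    case True
    then have "card (N x b) < s" using type(2)[OF x b] by simp
    then have "s \<le> card (S x b)" using card_SN[of x b] s by linarith
    then show ?thesis
      by (rule no[where v = z, rotated 2]) (use True Vn J[OF b] in \<open>auto simp: E_def S_def N_def\<close>)
  next
    case False
    then have "s \<le> card (N x b)" using type(2)[OF x b] by simp
    then show ?thesis
      by (rule no[where v = "\<not> z", rotated 2]) (use False Vn J[OF b] in \<open>auto simp: E_def S_def N_def\<close>)
  qed
  \<comment> \<open>Size \<open>2 * h\<close> is requested because \<open>F1\<close> discards two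
    sets of fewer than \<open>h\<close> rows from \<open>B\<close>.\<close>
  have "\<exists>A B. A \<subseteq> V \<and> B \<subseteq> V \<and> 2 * h \<le> real (card A) \<and> 2 * h \<le> real (card B) \<and>
      (\<forall>x\<in>A. \<forall>y\<in>B. incomparable E T x y)"
  proof (rule pl[unfolded pair_loss_def, rule_format], intro conjI)
    show "small_downsets E T V (2 * h)"
      unfolding small_downsets_def
    proof (intro conjI allI impI ballI)
      fix b x assume "b < T" "x \<in> V"
      then show "real (card {y\<in>V. E b y \<subseteq> E b x}) < 2 * h" using below[of b x] h by linarith
    qed (simp_all add: finV E_def fin)
    show "card V \<le> n" using card_mono[OF _ Vn] by simp
    have "real n \<le> real (4 ^ T * card V)" using ts unfolding V_def[symmetric] by (rule of_nat_mono)
    then have "real n \<le> real (card V) * 4 ^ T" by (simp add: mult.commute)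
    with n(1) have "2 * h * d * 4 ^ T \<le> real (card V) * 4 ^ T" by (rule order_trans)
    then show "2 * h * d \<le> real (card V)" by (rule mult_right_le_imp_le) simp
  qed (use h in simp)
  then obtain A B where AB: "A \<subseteq> V" "B \<subseteq> V" "2 * h \<le> real (card A)" "2 * h \<le> real (card B)"
    and inc: "\<forall>x\<in>A. \<forall>y\<in>B. incomparable E T x y" by (elim exE conjE)
  have finAB: "finite A" "finite B" using AB finV by (auto intro: finite_subset)
  have ab: "\<exists>c\<in>J b. M i c = z \<and> M j c \<noteq> z" "\<exists>c\<in>J b. M i c \<noteq> z \<and> M j c = z"
    if "i \<in> A" "j \<in> B" "b < T" for i j b
  proof -
    have "\<not> E b i \<subseteq> E b j" "\<not> E b j \<subseteq> E b i"
      using inc that by (auto simp: incomparable_def)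
    then have "\<not> S i b \<subseteq> S j b" "\<not> S j b \<subseteq> S i b"
      by (auto simp: E_def S_def N_def split: if_splits)
    then show "\<exists>c\<in>J b. M i c = z \<and> M j c \<noteq> z" "\<exists>c\<in>J b. M i c \<noteq> z \<and> M j c = z"
      by (auto simp: S_def)
  qed

  \<comment> \<open>Constant columns shown by the pair of row sets\<close>
  define both where "both i j b \<longleftrightarrow> (\<exists>c\<in>J b. M i c = z \<and> M j c = z)" for i j b
  define none where "none i j b \<longleftrightarrow> (\<exists>c\<in>J b. M i c \<noteq> z \<and> M j c \<noteq> z)" for i j b
  \<comment> \<open>Either row may be the upper one. Every block offers both mixed columns, and
    \<open>both\<close> and \<open>none\<close> are symmetric, so the pattern can be placed in
    either case.\<close>
  have avoid: False
    if ij: "i \<in> A" "j \<in> B" and uv: "x1 \<le> u" "u + (x2 - x1) \<le> v" "v + k < T"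
      and bn: "both i j u" "none i j v" for i j u v
  proof -
    note ab' = ab[OF ij, unfolded J_def]
    note bn' = bn(1)[unfolded both_def J_def] bn(2)[unfolded none_def J_def]
    have "0 < T" using uv by simp
    then have "i \<noteq> j" using ab(1)[OF ij, of 0] by auto
    have lt: "i < n" "j < n" using ij AB Vn by auto
    show False
    proof (cases "i < j")
      case True
      have "\<exists>s. strict_mono_on {..<k} s \<and> s ` {..<k} \<subseteq> {..<T*w} \<and>
         (\<forall>x<k. M i (s x) = p0 x \<and> M j (s x) = p1 x)"
        by (rule pattern_from_blocks[OF x(1) uv ab' bn' p])
      then show False using free[OF True lt(2)] by blast
    next
      case False
      then have "j < i" using \<open>i \<noteq> j\<close> by simp
      have "\<exists>s. strict_mono_on {..<k} s \<and> s ` {..<k} \<subseteq> {..<T*w} \<and>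
         (\<forall>x<k. M j (s x) = p0 x \<and> M i (s x) = p1 x)"
      proof (rule pattern_from_blocks[OF x(1) uv _ _ _ _ p])
        show "\<exists>c\<in>{b*w..<Suc b*w}. M j c = z \<and> M i c \<noteq> z" if "b < T" for b
          using ab'(2)[OF that] by blast
        show "\<exists>c\<in>{b*w..<Suc b*w}. M j c \<noteq> z \<and> M i c = z" if "b < T" for b
          using ab'(1)[OF that] by blast
      qed (use bn' in blast)+
      then show False using free[OF \<open>j < i\<close> lt(1)] by blast
    qed
  qed
  have sp_none: "none i j b" if "sp b" "b < T" "i \<in> V" "j \<in> V" for i j b
  proof (rule ccontr)
    assume "\<not> none i j b"
    then have "J b \<subseteq> S i b \<union> S j b" by (auto simp: none_def S_def)
    then have "w \<le> card (S i b \<union> S j b)" using card_mono[of "S i b \<union> S j b" "J b"] fin cardJ by simp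
    also have "\<dots> \<le> card (S i b) + card (S j b)" by (rule card_Un_le)
    finally show False using type(1)[of i b] type(1)[of j b] that s by simp
  qed
  have de_both: "both i j b" if "de b" "b < T" "i \<in> V" "j \<in> V" for i j b
  proof (rule ccontr)
    assume "\<not> both i j b"
    then have "J b \<subseteq> N i b \<union> N j b" by (auto simp: both_def N_def)
    then have "w \<le> card (N i b \<union> N j b)" using card_mono[of "N i b \<union> N j b" "J b"] fin cardJ by simp
    also have "\<dots> \<le> card (N i b) + card (N j b)" by (rule card_Un_le)
    finally show False using type(2)[of i b] type(2)[of j b] that s by simp
  qed
  \<comment> \<open>The columns where some row of \<open>A\<close> shows \<open>g\<close> and those
    where some row of \<open>B\<close> does are disjoint, so one of these unions misses at least
    \<open>s\<close> columns of the block. The corresponding row set is constant there, yet has at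
    least \<open>2 * h\<close> rows.\<close>
  have disjoint: False
    if b: "b < T" and dis: "\<And>i j c. i \<in> A \<Longrightarrow> j \<in> B \<Longrightarrow> c \<in> J b \<Longrightarrow> M i c = g \<Longrightarrow> M j c = g \<Longrightarrow> False" for b g
  proof -
    define U where "U X = {c\<in>J b. \<exists>i\<in>X. M i c = g}" for X :: "nat set"
    have U: "real (card X) < h" if "X \<subseteq> V" "s \<le> card (J b - U X)" for X
      using that(2) by (rule no[where v = "\<not> g", rotated 2])
        (use that(1) Vn J[OF b] in \<open>auto simp: U_def\<close>)
    have UJ: "U X \<subseteq> J b" for X by (auto simp: U_def)
    have "U A \<inter> U B = {}" using dis by (auto simp: U_def)
    then have "card (U A) + card (U B) = card (U A \<union> U B)"
      by (intro card_Un_disjoint[symmetric] finite_subset[OF UJ finJ])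
    also have "\<dots> \<le> w" using card_mono[OF finJ, of "U A \<union> U B" b] UJ cardJ by simp
    finally have "card (U A) + card (U B) \<le> w" .
    moreover have "card (J b - U X) = w - card (U X)" for X
      using card_Diff_subset[OF finite_subset[OF UJ finJ] UJ] cardJ by simp
    ultimately have "s \<le> card (J b - U A) \<or> s \<le> card (J b - U B)" using s by simp linarith
    then show False using U[OF AB(1)] U[OF AB(2)] AB(3,4) h by auto
  qed

  \<comment> \<open>The four candidate blocks\<close>
  have pos: "x1 \<le> K * a" "K * a + (x2 - x1) \<le> K * a'" "K * a' + k < T" "K * a < T" "K * a' < T"
    if "1 \<le> a" "a < a'" "a' \<le> 4" for a a'
  proof -
    have "K * 1 \<le> K * a" "K * Suc a \<le> K * a'" "K * a' \<le> K * 4"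
      using that by (intro mult_le_mono2; simp)+
    then have "K \<le> K * a" "K + K * a \<le> K * a'" "K * a' \<le> 4 * K" by (simp_all add: mult.commute)
    then show "x1 \<le> K * a" "K * a + (x2 - x1) \<le> K * a'" "K * a' + k < T" "K * a < T" "K * a' < T"
      using x unfolding T_def by linarith+
  qed
  \<comment> \<open>Fix a row \<open>i\<close> of \<open>A\<close> with at least \<open>s\<close>
    entries \<open>z\<close> in the left block and at least \<open>s\<close> other entries in the
    right one. Fewer than \<open>h\<close> rows of \<open>B\<close> fail \<open>both\<close> on the
    left, as these are constant on such columns; likewise for \<open>none\<close> on the right. A
    remaining row of \<open>B\<close> contradicts \<open>avoid\<close>.\<close>
  have F1: "sp (K * a) \<or> de (K * a')" if a: "1 \<le> a" "a < a'" "a' \<le> 4" for a a'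
  proof (rule ccontr)
    note pos = pos[OF a]
    assume *: "\<not> ?thesis"
    have "A \<noteq> {}" using AB(3) h by auto
    then obtain i where i: "i \<in> A" by blast
    then have iV: "i \<in> V" using AB by blast
    have "s \<le> card (S i (K * a))" using type(1)[OF iV pos(4)] * by simp
    then have 1: "real (card {j\<in>B. \<not> both i j (K * a)}) < h"
      by (rule no[where v = "\<not> z", rotated 2])
        (use AB Vn J[OF pos(4)] in \<open>auto simp: both_def S_def\<close>)
    have "s \<le> card (N i (K * a'))" using type(2)[OF iV pos(5)] * by simp
    then have 2: "real (card {j\<in>B. \<not> none i j (K * a')}) < h"
      by (rule no[where v = z, rotated 2])
        (use AB Vn J[OF pos(5)] in \<open>auto simp: none_def N_def\<close>)
    have "B \<subseteq> {j\<in>B. \<not> both i j (K * a)} \<union> {j\<in>B. \<not> none i j (K * a')}"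
      using avoid[OF i _ pos(1-3)] by blast
    then have "card B \<le> card ({j\<in>B. \<not> both i j (K * a)} \<union> {j\<in>B. \<not> none i j (K * a')})"
      using finAB by (intro card_mono) auto
    also have "\<dots> \<le> card {j\<in>B. \<not> both i j (K * a)} + card {j\<in>B. \<not> none i j (K * a')}"
      by (rule card_Un_le)
    finally show False using 1 2 AB(4) by linarith
  qed
  \<comment> \<open>Sparseness gives \<open>none\<close> in the right block, so by
    \<open>avoid\<close> the \<open>z\<close>-entries of the two row sets are disjoint in the left
    block. \<open>F3\<close> is dual, with the blocks exchanged.\<close>
  have F2: "\<not> (sp (K * a) \<and> sp (K * a'))" if a: "1 \<le> a" "a < a'" "a' \<le> 4" for a a'
  proof
    note pos = pos[OF a]
    assume *: "sp (K * a) \<and> sp (K * a')"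
    have "\<not> both i j (K * a)" if "i \<in> A" "j \<in> B" for i j
      using avoid[OF that pos(1-3)]
        sp_none[OF *[THEN conjunct2] pos(5) subsetD[OF AB(1) that(1)] subsetD[OF AB(2) that(2)]] by blast
    then show False
      using disjoint[OF pos(4), of z] by (auto simp: both_def)
  qed
  have F3: "\<not> (de (K * a) \<and> de (K * a'))" if a: "1 \<le> a" "a < a'" "a' \<le> 4" for a a'
  proof
    note pos = pos[OF a]
    assume *: "de (K * a) \<and> de (K * a')"
    have "\<not> none i j (K * a')" if "i \<in> A" "j \<in> B" for i j
      using avoid[OF that pos(1-3)]
        de_both[OF *[THEN conjunct1] pos(4) subsetD[OF AB(1) that(1)] subsetD[OF AB(2) that(2)]] by blast
    then show False
      using disjoint[OF pos(5), of "\<not> z"] by (auto simp: none_def)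
  qed
  \<comment> \<open>If the first block is not sparse, \<open>F1\<close> makes the second and third
    dense, against \<open>F3\<close>. If it is sparse, \<open>F2\<close> excludes this for the
    second and third, so \<open>F1\<close> makes the third and fourth dense, again against
    \<open>F3\<close>.\<close>
  show False
    using F1[of 1 2] F1[of 1 3] F1[of 2 3] F1[of 3 4] F2[of 1 2] F2[of 1 3] F3[of 2 3] F3[of 3 4] by auto
qed

section \<open>Simple matrices with two rows\<close>

lemma strict_mono_into_finite:
  fixes R :: "nat set"
  assumes "finite R" "m \<le> card R"
  shows "\<exists>r. strict_mono_on {..<m} r \<and> r ` {..<m} \<subseteq> R"
proof (intro exI conjI)
  let ?r = "\<lambda>i. sorted_list_of_set R ! i"
  have "sorted_wrt (<) (sorted_list_of_set R)" by (rule strict_sorted_list_of_set)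
  then show "strict_mono_on {..<m} ?r"
    using assms by (auto intro!: strict_mono_onI sorted_wrt_nth_less[of "(<)" "sorted_list_of_set R"])
  have "?r i \<in> set (sorted_list_of_set R)" if "i < m" for i
    using that assms by (intro nth_mem) auto
  then show "?r ` {..<m} \<subseteq> R" using assms(1) by auto
qed

lemma mat_contains_constant:
  assumes "A \<in> carrier_mat n n'" "R \<subseteq> {..<n}" "C \<subseteq> {..<n'}" "m \<le> card R" "l \<le> card C"
    and "\<And>i c. i \<in> R \<Longrightarrow> c \<in> C \<Longrightarrow> A $$ (i, c) = v"
  shows "mat_contains A (mat m l (\<lambda>_. v))"
proof -
  obtain r where r: "strict_mono_on {..<m} r" "r ` {..<m} \<subseteq> R"
    using strict_mono_into_finite[OF finite_subset[OF assms(2)] assms(4)] by auto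
  obtain s where s: "strict_mono_on {..<l} s" "s ` {..<l} \<subseteq> C"
    using strict_mono_into_finite[OF finite_subset[OF assms(3)] assms(5)] by auto
  have "A $$ (r a, s b) = v" if "a < m" "b < l" for a b
    using that r(2) s(2) by (intro assms(6)) auto
  then show ?thesis
    unfolding mat_contains_def using assms(1-3) r s
    by (intro exI[of _ r] exI[of _ s]) auto
qed

lemma homogeneous_mat_constant: "homogeneous_mat (mat m l (\<lambda>_. v))"
  by (auto simp: homogeneous_mat_def)

text \<open>Two all-one columns would form an all-one \<open>2 \<times> 2\<close> submatrix, with
  two 1-entries in every row and column.\<close>

lemma acyclic_mat_full_column:
  assumes "acyclic_mat P" "P \<in> carrier_mat 2 k"
    and "x < k" "P $$ (0, x)" "P $$ (1, x)" and "y < k" "P $$ (0, y)" "P $$ (1, y)"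
  shows "x = y"
proof -
  have no: False
    if "x < y" "y < k" "P $$ (0, x)" "P $$ (1, x)" "P $$ (0, y)" "P $$ (1, y)" for x y
  proof -
    let ?B = "mat 2 2 (\<lambda>_. True)"
    have "mat_contains P ?B"
      unfolding mat_contains_def
    proof (intro exI conjI)
      show "strict_mono_on {..<dim_row ?B} (\<lambda>i. i)" by (auto intro: strict_mono_onI)
      show "strict_mono_on {..<dim_col ?B} (\<lambda>b. if b = 0 then x else y)"
        using that by (auto intro!: strict_mono_onI)
    qed (use that assms(2) in \<open>auto simp: less_2_cases_iff\<close>)
    then have "(\<exists>i<2. card {j. j < 2 \<and> ?B $$ (i, j)} \<le> 1) \<or> (\<exists>j<2. card {i. i < 2 \<and> ?B $$ (i, j)} \<le> 1)"
      using assms(1)[unfolded acyclic_mat_def, rule_format, of ?B] by simp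
    moreover have "card {j. j < 2 \<and> ?B $$ (i, j)} = 2" "card {j. j < 2 \<and> ?B $$ (j, i)} = 2" if "i < 2" for i
    proof -
      have "{j. j < 2 \<and> ?B $$ (i, j)} = {..<2}" "{j. j < 2 \<and> ?B $$ (j, i)} = {..<2}"
        using that by auto
      then show "card {j. j < 2 \<and> ?B $$ (i, j)} = 2" "card {j. j < 2 \<and> ?B $$ (j, i)} = 2"
        by simp_all
    qed
    ultimately show False by auto
  qed
  show ?thesis
    using no[of x y] no[of y x] assms by (metis linorder_neqE_nat)
qed

text \<open>The value \<open>z\<close> belongs to the special column further left, so the block
  argument treats both orders at once.\<close>

lemma simple_mat_special_columns:
  assumes P: "P \<in> carrier_mat 2 k" "simple_mat P"
  obtains x1 x2 z where "x1 < x2" "x2 < k + 2"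
    "\<forall>x<k. P $$ (0, x) = z \<longrightarrow> P $$ (1, x) = z \<longrightarrow> x = x1"
    "\<forall>x<k. P $$ (0, x) \<noteq> z \<longrightarrow> P $$ (1, x) \<noteq> z \<longrightarrow> x = x2"
proof -
  have ones: "x = y" if "x < k" "P $$ (0, x)" "P $$ (1, x)" "y < k" "P $$ (0, y)" "P $$ (1, y)" for x y
    using acyclic_mat_full_column[of P k] P that by (auto simp: simple_mat_def)
  have zeros: "x = y"
    if "x < k" "\<not> P $$ (0, x)" "\<not> P $$ (1, x)" "y < k" "\<not> P $$ (0, y)" "\<not> P $$ (1, y)" for x y
  proof (rule acyclic_mat_full_column)
    show "acyclic_mat (complement_mat P)" using P by (simp add: simple_mat_def)
    show "complement_mat P \<in> carrier_mat 2 k" using P by (simp add: complement_mat_def)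
  qed (use that P in \<open>auto simp: complement_mat_def\<close>)
  \<comment> \<open>Indices \<open>k\<close> and \<open>k + 1\<close> stand for an all-one or all-zero column that \<open>P\<close> lacks.\<close>
  have "\<exists>c. (c = k \<or> c < k \<and> P $$ (0, c)) \<and> (\<forall>x<k. P $$ (0, x) \<longrightarrow> P $$ (1, x) \<longrightarrow> x = c)"
    by (cases "\<exists>c<k. P $$ (0, c) \<and> P $$ (1, c)") (use ones in \<open>blast, auto\<close>)
  then obtain c where c: "c = k \<or> c < k \<and> P $$ (0, c)"
    "\<And>x. x < k \<Longrightarrow> P $$ (0, x) \<Longrightarrow> P $$ (1, x) \<Longrightarrow> x = c" by auto
  have "\<exists>d. (d = k + 1 \<or> d < k \<and> \<not> P $$ (0, d)) \<and> (\<forall>x<k. \<not> P $$ (0, x) \<longrightarrow> \<not> P $$ (1, x) \<longrightarrow> x = d)"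
    by (cases "\<exists>d<k. \<not> P $$ (0, d) \<and> \<not> P $$ (1, d)") (use zeros in \<open>blast, auto\<close>)
  then obtain d where d: "d = k + 1 \<or> d < k \<and> \<not> P $$ (0, d)"
    "\<And>x. x < k \<Longrightarrow> \<not> P $$ (0, x) \<Longrightarrow> \<not> P $$ (1, x) \<Longrightarrow> x = d" by auto
  have "c \<noteq> d"
  proof
    assume "c = d"
    then show False using c(1) d(1) by (elim disjE conjE) simp_all
  qed
  then consider "c < d" | "d < c" by (rule linorder_neqE_nat)
  then show thesis
  proof cases
    case 1
    have "d < k + 2" using d(1) by linarith
    show thesis by (rule that[OF 1 \<open>d < k + 2\<close>, of True]) (use c(2) d(2) in simp_all)
  next
    case 2
    have "c < k + 2" using c(1) by linarith
    show thesis by (rule that[OF 2 \<open>c < k + 2\<close>, of False]) (use c(2) d(2) in simp_all)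
  qed
qed

theorem theorem2p3:
  fixes P :: "bool mat" and k :: nat
  assumes "P \<in> carrier_mat 2 k"
    and "simple_mat P"
  shows "\<exists>(c::real) (f :: nat \<Rightarrow> real). c > 0 \<and> near_linear f \<and>
    (\<forall>n. \<forall>A :: bool mat. A \<in> carrier_mat n n \<and> mat_free P A \<longrightarrow>
      (\<exists>B \<in> carrier_mat (nat \<lceil>f n\<rceil>) (nat \<lceil>c * real n\<rceil>).
         mat_contains A B \<and> homogeneous_mat B))"
proof -
  obtain x1 x2 z where x: "x1 < x2" "x2 < k + 2"
    and p: "\<forall>x<k. P $$ (0, x) = z \<longrightarrow> P $$ (1, x) = z \<longrightarrow> x = x1"
      "\<forall>x<k. P $$ (0, x) \<noteq> z \<longrightarrow> P $$ (1, x) \<noteq> z \<longrightarrow> x = x2"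
    by (rule simple_mat_special_columns[OF assms])
  define T where "T = 5 * (k + 2)"
  have T: "0 < T" by (simp add: T_def)
  \<comment> \<open>For \<open>n \<ge> 8 * T\<close>, rounding up gives \<open>s\<close> at most
    \<open>n / (4 * T)\<close>, while a block has at least \<open>n / (2 * T)\<close> columns; hence
    \<open>2 * s \<le> w\<close>.\<close>
  define c where "c = 1 / (8 * real T)"
  have c: "0 < c" "c \<le> 1" using T by (auto simp: c_def field_simps)
  define G where "G n h \<longleftrightarrow> (\<forall>A :: bool mat. A \<in> carrier_mat n n \<and> mat_free P A \<longrightarrow>
      (\<exists>B \<in> carrier_mat (nat \<lceil>h\<rceil>) (nat \<lceil>c * real n\<rceil>). mat_contains A B \<and> homogeneous_mat B))" for n and h :: real
  \<comment> \<open>With no rows nothing has to be found. This covers the \<open>n\<close> with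
    \<open>f n = 0\<close>, where no exponent is available yet.\<close>
  have G0: "G n 0" for n
    unfolding G_def
  proof (intro allI impI, elim conjE)
    fix A :: "bool mat" assume A: "A \<in> carrier_mat n n"
    have "c * real n \<le> real n" using c by (simp add: mult_left_le_one_le)
    then have "nat \<lceil>c * real n\<rceil> \<le> card {..<n}" by (simp add: nat_le_iff ceiling_le_iff)
    then have "mat_contains A (mat 0 (nat \<lceil>c * real n\<rceil>) (\<lambda>_. True))"
      by (intro mat_contains_constant[OF A, of "{}" "{..<n}"]) auto
    then show "\<exists>B \<in> carrier_mat (nat \<lceil>0::real\<rceil>) (nat \<lceil>c * real n\<rceil>). mat_contains A B \<and> homogeneous_mat B"
      using homogeneous_mat_constant by (intro bexI) auto
  qed
  have ev: "\<forall>\<^sub>F n in sequentially. G n (real n powr (1 - \<epsilon>))" if "0 < \<epsilon>" for \<epsilon>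
  proof -
    \<comment> \<open>Half of \<open>\<epsilon>\<close> pays for the loss \<open>d\<close>, the
      other half for the constant \<open>2 * 4 ^ T\<close>.\<close>
    have "\<forall>\<^sub>F n in sequentially. 2 * real n powr (1 - \<epsilon>) * real n powr (\<epsilon> / 2) * 4 ^ T \<le> real n"
      using that by real_asymp
    moreover have "\<forall>\<^sub>F n in sequentially. \<exists>d. 1 \<le> d \<and> d \<le> real n powr (\<epsilon> / 2) \<and> pair_loss TYPE(nat \<times> nat) T n d"
      using that by (intro pair_loss_subpolynomial) simp
    ultimately show ?thesis
      using eventually_ge_at_top[of "8 * T"]
    proof eventually_elim
      case (elim n)
      then obtain d where d: "1 \<le> d" "d \<le> real n powr (\<epsilon> / 2)" "pair_loss TYPE(nat \<times> nat) T n d" by blast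
      define h where "h = real n powr (1 - \<epsilon>)"
      have n0: "0 < n" using elim(3) T by simp
      then have h: "0 < h" by (simp add: h_def)
      define w where "w = n div T"
      define s where "s = nat \<lceil>c * real n\<rceil>"
      have sw: "2 * s \<le> w"
      proof -
        have "1 \<le> c * real n"
          using elim(3) T by (simp add: c_def field_simps flip: of_nat_mult)
        then have "real s \<le> 2 * (c * real n)" unfolding s_def by (simp add: of_nat_nat) linarith
        then have "2 * real s \<le> real n / (2 * real T)" by (simp add: c_def)
        moreover have "n < (w + 1) * T"
          unfolding w_def using T by (metis Suc_eq_plus1 dividend_less_div_times mult_Suc)
        then have "real n < real ((w + 1) * T)" by (simp only: of_nat_less_iff)
        then have "real n / real T < real w + 1" using T by (simp add: field_simps)
        moreover have "8 \<le> real n / real T"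
          using elim(3) T by (simp add: field_simps flip: of_nat_mult)
        ultimately have "2 * real s \<le> real w" by (simp add: field_simps)
        then show ?thesis by linarith
      qed
      have Tw: "{..<T * w} \<subseteq> {..<n}" unfolding w_def by (auto intro: order_less_le_trans)
      show ?case
        unfolding G_def h_def[symmetric] s_def[symmetric]
      proof (intro allI impI, elim conjE)
        fix A :: "bool mat" assume A: "A \<in> carrier_mat n n" and free: "mat_free P A"
        have "\<exists>R\<subseteq>{..<n}. \<exists>C\<subseteq>{..<5 * (k + 2) * w}. \<exists>v. h \<le> real (card R) \<and> s \<le> card C \<and>
            (\<forall>i\<in>R. \<forall>c\<in>C. A $$ (i, c) = v)"
        proof (rule homogeneous_rows_from_blocks[where ?p0.0 = "\<lambda>x. P $$ (0, x)" and ?p1.0 = "\<lambda>x. P $$ (1, x)", OF x _ p[rule_format]])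
          fix i j t
          assume ij: "i < j" "j < n" and t: "strict_mono_on {..<k} t" "t ` {..<k} \<subseteq> {..<5 * (k + 2) * w}"
          show "\<exists>x<k. A $$ (i, t x) \<noteq> P $$ (0, x) \<or> A $$ (j, t x) \<noteq> P $$ (1, x)"
          proof (rule ccontr)
            assume eq: "\<not> ?thesis"
            have "mat_contains A P"
              unfolding mat_contains_def
            proof (intro exI conjI)
              show "strict_mono_on {..<dim_row P} (\<lambda>a. if a = 0 then i else j)"
                using ij assms(1) by (auto intro!: strict_mono_onI)
              show "(\<lambda>a. if a = 0 then i else j) ` {..<dim_row P} \<subseteq> {..<dim_row A}"
                using ij A by auto
              show "strict_mono_on {..<dim_col P} t" using t(1) assms(1) by simp
              show "t ` {..<dim_col P} \<subseteq> {..<dim_col A}"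
                using t(2) assms(1) A Tw unfolding T_def by (auto simp: subset_iff)
              show "\<forall>a<dim_row P. \<forall>b<dim_col P. A $$ (if a = 0 then i else j, t b) = P $$ (a, b)"
                using eq assms(1) by (auto simp: less_2_cases_iff)
            qed
            then show False using free by (simp add: mat_free_def)
          qed
        next
          have "2 * h * d * 4 ^ T \<le> 2 * h * real n powr (\<epsilon> / 2) * 4 ^ T"
            using h d(2) by (intro mult_right_mono mult_left_mono) auto
          also have "\<dots> \<le> real n" using elim(1) by (simp add: h_def)
          finally show "2 * h * d * 4 ^ (5 * (k + 2)) \<le> real n" by (simp add: T_def)
        qed (use h d sw n0 in \<open>auto simp: T_def\<close>)
        then obtain R C v where RC: "R \<subseteq> {..<n}" "C \<subseteq> {..<T * w}" "h \<le> real (card R)" "s \<le> card C"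
          "\<forall>i\<in>R. \<forall>c\<in>C. A $$ (i, c) = v" unfolding T_def by (elim exE conjE)
        have "mat_contains A (mat (nat \<lceil>h\<rceil>) s (\<lambda>_. v))"
          using RC(5) by (intro mat_contains_constant[OF A RC(1) subset_trans[OF RC(2) Tw] _ RC(4)])
            (auto simp: nat_le_iff ceiling_le_iff RC(3))
        then show "\<exists>B\<in>carrier_mat (nat \<lceil>h\<rceil>) s. mat_contains A B \<and> homogeneous_mat B"
          using homogeneous_mat_constant by (intro bexI) auto
      qed
    qed
  qed
  \<comment> \<open>Diagonalisation: \<open>1 - 1 / \<mu> n\<close> is the best exponent that works from \<open>n\<close> on, and \<open>\<mu> n = 0\<close>
    encodes that there is none.\<close>
  define good where "good n m \<longleftrightarrow> m = 0 \<or> (\<forall>n'\<ge>n. G n' (real n' powr (1 - 1 / real m)))" for n m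
  define \<mu> where "\<mu> n = Max {m. m \<le> n \<and> good n m}" for n
  have fin: "finite {m. m \<le> n \<and> good n m}" for n by simp
  have "\<mu> n \<in> {m. m \<le> n \<and> good n m}" for n
    unfolding \<mu>_def by (rule Max_in[OF fin]) (auto simp: good_def)
  then have good: "good n (\<mu> n)" for n by simp
  \<comment> \<open>A fixed \<open>m\<close> is admissible once \<open>n\<close> passes both
    \<open>m\<close> and the threshold from \<open>ev\<close>. Hence \<open>\<mu>\<close> tends to
    infinity and \<open>1 / \<mu> n\<close> can serve as the \<open>o(1)\<close> in the
    exponent.\<close>
  have large: "\<forall>\<^sub>F n in sequentially. m \<le> \<mu> n" for m
  proof (cases "m = 0")
    case False
    obtain n0 where n0: "\<And>n. n0 \<le> n \<Longrightarrow> G n (real n powr (1 - 1 / real m))"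
      using ev[of "1 / real m"] False unfolding eventually_sequentially by auto
    have "m \<le> \<mu> n" if "max n0 m \<le> n" for n
      unfolding \<mu>_def by (rule Max_ge[OF fin]) (use that n0 in \<open>auto simp: good_def\<close>)
    then show ?thesis unfolding eventually_sequentially by blast
  qed simp
  then have lim: "filterlim \<mu> at_top sequentially" by (simp add: filterlim_at_top)
  define f where "f n = (if \<mu> n = 0 then 0 else real n powr (1 - 1 / real (\<mu> n)))" for n
  have "(\<lambda>n. 1 / real (\<mu> n)) \<longlonglongrightarrow> 0"
    by (rule filterlim_compose[OF lim_1_over_n lim])
  then have "(\<lambda>n. 1 / real (\<mu> n)) \<in> o(\<lambda>_. 1)" by (intro smalloI_tendsto) auto
  moreover have "\<forall>\<^sub>F n in sequentially. f n = real n powr (1 - 1 / real (\<mu> n))"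
    using large[of 1] by eventually_elim (auto simp: f_def)
  ultimately have "near_linear f" unfolding near_linear_def by blast
  moreover have "G n (f n)" for n
    using good[of n] G0[of n] by (auto simp: f_def good_def)
  ultimately show ?thesis using c(1) unfolding G_def by blast
qed

end
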